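(* Let $m$ be a positive integer. Then each of the Diophantine equations \[ x^2=(2^{3m}+1)2^{n}+1-2^{3m+3}, \qquad x^2=\tfrac{1}{9}(2^{6m}-1)2^{n}+\tfrac{1}{9}(2^{6m+3}+1) \] has at least five solutions $(x,n)$ with $x$ a positive integer and $n$ a non-negative integer. More precisely, the following pairs $(x,n)$ are solutions of the first equation: \[ (3,3),\ (2^{2m+1}-2^{m+1}-1,\ m+2),\ (2^{3m+1}-1,\ 3m+2),\ (2^{3m+2}+1,\ 3m+4),\ (2^{6m+3}+2^{3m+2}-1,\ 9m+6), \] and the following pairs $(x,n)$ are solutions of the second equation: \[ (2^{3m},0),\ \Big(\tfrac{1}{3}(2^{4m+1}+2^{2m+1}-1),\ 2m+2\Big),\ \Big(\tfrac{1}{3}(2^{6m+1}+1),\ 6m+2\Big),\ \Big(\tfrac{1}{3}(2^{6m+2}-1),\ 6m+4\Big),\ \Big(\tfrac{1}{3}(2^{3(4m+1)}-2^{2(3m+1)}-1),\ 18m+6\Big). \] *)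

theory Defs
  imports Complex_Main
begin

definition sols1 :: "nat \<Rightarrow> (int \<times> nat) set" where
  "sols1 m = {(x, n). 0 < x \<and> x^2 = (2^(3*m) + 1) * 2^n + 1 - 2^(3*m+3)}"

text \<open>
  The second equation has rational coefficients, so it is read in the rationals, with
  \<open>x\<close> required to be a positive integer.
\<close>
definition sols2 :: "nat \<Rightarrow> (rat \<times> nat) set" where
  "sols2 m = {(x, n). x \<in> \<int> \<and> 0 < x \<and>
     x^2 = 1/9 * (2^(6*m) - 1) * 2^n + 1/9 * (2^(6*m+3) + 1)}"

end

theory Submission imports Defs begin

text \<open>
  Put \<open>a = 2^m\<close> and \<open>b = 4^m\<close>: every listed pair turns its equation into a polynomial identity in
  \<open>a\<close> or \<open>b\<close>, and integrality in the second equation follows from \<open>b \<equiv> 1 (mod 3)\<close>. The exponents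
  \<open>n\<close> in each list are distinct, except that for \<open>m = 1\<close> the first two pairs of the first list
  both equal \<open>(3, 3)\<close>. There the equation is nine times the Ramanujan--Nagell equation
  \<open>y^2 = 2^n - 7\<close>, whose solution \<open>(3, 4)\<close> supplies the missing \<open>(9, 4)\<close>.
\<close>

lemma listed_subset_sols1:
  assumes "m > 0"
  shows "{(3, 3),
          (2^(2*m+1) - 2^(m+1) - 1, m+2),
          (2^(3*m+1) - 1, 3*m+2),
          (2^(3*m+2) + 1, 3*m+4),
          (2^(6*m+3) + 2^(3*m+2) - 1, 9*m+6)} \<subseteq> sols1 m"
proof -
  define a :: int where "a = 2^m"
  have a: "a \<ge> 2"
    using assms power_increasing[of 1 m "2::int"] by (simp add: a_def)
  have pow: "2^(k*m + j) = a^k * 2^j" for k j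
    by (simp add: a_def power_add mult.commute flip: power_mult)
  \<comment> \<open>The instances catch exponents whose coefficient is 1 or whose offset is 0, which
    do not literally have the form \<open>k*m + j\<close>.\<close>
  note pows = pow[of 1, simplified] pow pow[of _ 0, simplified]
  have pos2: "2 * a^2 - 2 * a - 1 > 0"
    \<comment> \<open>This is \<open>2 * 1 \<le> a * (a - 1)\<close>, so the left side is at least
      3; at \<open>a = 1\<close> it would be -1.\<close>
    using mult_mono[of 2 a 1 "a - 1"] a by (simp add: power2_eq_square algebra_simps)
  have pos3: "2 * a^3 - 1 > 0" "4 * a^3 + 1 > 0" "8 * a^6 + 4 * a^3 - 1 > 0"
    using one_le_power[of a 3] one_le_power[of a 6] a by linarith+
  have "(3, 3) \<in> sols1 m"
    by (simp add: sols1_def pows)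
  moreover have "(2^(2*m+1) - 2^(m+1) - 1, m+2) \<in> sols1 m"
    unfolding sols1_def mem_Collect_eq prod.case pows
    by (intro conjI) (use pos2 in \<open>simp add: mult.commute\<close>, algebra)
  moreover have "(2^(3*m+1) - 1, 3*m+2) \<in> sols1 m"
    unfolding sols1_def mem_Collect_eq prod.case pows
    by (intro conjI) (use pos3 in \<open>simp add: mult.commute\<close>, algebra)
  moreover have "(2^(3*m+2) + 1, 3*m+4) \<in> sols1 m"
    unfolding sols1_def mem_Collect_eq prod.case pows
    by (intro conjI) (use pos3 in \<open>simp add: mult.commute\<close>, algebra)
  moreover have "(2^(6*m+3) + 2^(3*m+2) - 1, 9*m+6) \<in> sols1 m"
    unfolding sols1_def mem_Collect_eq prod.case pows
    by (intro conjI) (use pos3 in \<open>simp add: mult.commute\<close>, algebra)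
  ultimately show ?thesis by blast
qed

text \<open>Clears the denominators: the integer \<open>y\<close> witnesses that \<open>x\<close> is
  integral, and nine times the equation is an identity between integers.\<close>

lemma sols2I:
  fixes y :: int
  assumes "3 * x = of_int (3 * y)" and "0 < y"
    and eq: "(3 * y)^2 = (2^(6*m) - 1) * 2^n + 2^(6*m+3) + 1"
  shows "(x, n) \<in> sols2 m"
proof -
  have x: "x = of_int y" using assms(1) by simp
  have "9 * x^2 = of_int ((3 * y)^2)" by (simp add: x)
  also have "\<dots> = (2^(6*m) - 1) * 2^n + 2^(6*m+3) + 1" unfolding eq by simp
  finally show ?thesis using \<open>0 < y\<close> by (simp add: sols2_def x field_simps)
qed

text \<open>Since 4 is 1 modulo 3, so is each of its powers. Writing the power as
  \<open>3*k + 1\<close> turns the later divisions by 3 into polynomials in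
  \<open>k\<close>.\<close>

lemma power_two_even:
  obtains k :: int where "2^(2*m) = 3*k + 1" and "m > 0 \<Longrightarrow> k > 0"
proof -
  have "(4::int)^m mod 3 = 1"
    using power_mod[of "4::int" 3 m] by simp
  then obtain k :: int where k: "4^m = 3*k + 1"
    by (metis mult_div_mod_eq)
  have "k > 0" if "m > 0"
    using that k power_increasing[of 1 m "4::int"] by simp
  with k show thesis by (intro that[of k]) (simp_all add: power_mult)
qed

lemma listed_subset_sols2:
  assumes "m > 0"
  shows "{(2^(3*m), 0),
          (1/3 * (2^(4*m+1) + 2^(2*m+1) - 1), 2*m+2),
          (1/3 * (2^(6*m+1) + 1), 6*m+2),
          (1/3 * (2^(6*m+2) - 1), 6*m+4),
          (1/3 * (2^(3*(4*m+1)) - 2^(2*(3*m+1)) - 1), 18*m+6)} \<subseteq> sols2 m"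
proof -
  \<comment> \<open>Only the second pair needs \<open>k\<close>. The last three involve
    \<open>m\<close> only through \<open>2^(6*m)\<close>, so \<open>c\<close> gives identities of
    lower degree.\<close>
  obtain k where k: "(2::int)^(2*m) = 3*k + 1" and "k > 0"
    using power_two_even[of m] assms by auto
  obtain c where c: "(2::int)^(6*m) = 3*c + 1" and "c > 0"
    using power_two_even[of "3*m"] assms by auto
  \<comment> \<open>The ring is left general because the rewriting is needed both in
    \<open>rat\<close>, to identify \<open>x\<close>, and in \<open>int\<close>, for the
    equation.\<close>
  have powk: "(2::'a::comm_ring_1)^(i*(2*m) + j) = of_int (3*k + 1)^i * 2^j" for i j
    unfolding k[symmetric] by (simp add: power_add mult.commute flip: power_mult)
  note powsk = powk[of 1, simplified] powk[of 2, simplified] powk[of 3, simplified]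
    powk[of 3 0, simplified]
  have powc: "(2::'a::comm_ring_1)^(i*(6*m) + j) = of_int (3*c + 1)^i * 2^j" for i j
    unfolding c[symmetric] by (simp add: power_add mult.commute flip: power_mult)
  note powsc = powc[of 1, simplified] powc[of 2, simplified] powc[of 3, simplified]
    powc[of 1 0, simplified]
  have pos: "k^2 > 0" "c^2 > 0"
    using \<open>k > 0\<close> \<open>c > 0\<close> by simp_all
  have exps: "3*(4*m+1) = 12*m+3" "2*(3*m+1) = 6*m+2"
    by simp_all
  have "(2^(3*m), 0) \<in> sols2 m"
  proof (rule sols2I)
    show "3 * 2^(3*m) = (of_int (3 * 2^(3*m)) :: rat)" by simp
    show "(0::int) < 2^(3*m)" by simp
    show "(3 * 2^(3*m))^2 = (2^(6*m) - 1) * 2^0 + 2^(6*m+3) + (1::int)"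
      by (simp add: power_mult_distrib power_add flip: power_mult)
  qed
  moreover have "(1/3 * (2^(4*m+1) + 2^(2*m+1) - 1), 2*m+2) \<in> sols2 m"
  proof (rule sols2I)
    \<comment> \<open>The witness is \<open>(2*b^2 + 2*b - 1) / 3\<close> expanded at
      \<open>b = 3*k + 1\<close>.\<close>
    show "3 * (1/3 * (2^(4*m+1) + 2^(2*m+1) - 1)) = (of_int (3 * (6*k^2 + 6*k + 1)) :: rat)"
      unfolding powsk by (simp add: algebra_simps power2_eq_square)
    show "0 < 6*k^2 + 6*k + 1"
      using \<open>k > 0\<close> pos by simp
    show "(3 * (6*k^2 + 6*k + 1))^2 = (2^(6*m) - 1) * 2^(2*m+2) + 2^(6*m+3) + 1"
      unfolding powsk by simp algebra
  qed
  moreover have "(1/3 * (2^(6*m+1) + 1), 6*m+2) \<in> sols2 m"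
  proof (rule sols2I)
    show "3 * (1/3 * (2^(6*m+1) + 1)) = (of_int (3 * (2*c + 1)) :: rat)"
      unfolding powsc by (simp add: algebra_simps power2_eq_square)
    show "0 < 2*c + 1"
      using \<open>c > 0\<close> pos by simp
    show "(3 * (2*c + 1))^2 = (2^(6*m) - 1) * 2^(6*m+2) + 2^(6*m+3) + 1"
      unfolding powsc by simp algebra
  qed
  moreover have "(1/3 * (2^(6*m+2) - 1), 6*m+4) \<in> sols2 m"
  proof (rule sols2I)
    show "3 * (1/3 * (2^(6*m+2) - 1)) = (of_int (3 * (4*c + 1)) :: rat)"
      unfolding powsc by (simp add: algebra_simps power2_eq_square)
    show "0 < 4*c + 1"
      using \<open>c > 0\<close> pos by simp
    show "(3 * (4*c + 1))^2 = (2^(6*m) - 1) * 2^(6*m+4) + 2^(6*m+3) + 1"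
      unfolding powsc by simp algebra
  qed
  moreover have "(1/3 * (2^(3*(4*m+1)) - 2^(2*(3*m+1)) - 1), 18*m+6) \<in> sols2 m"
  proof (rule sols2I)
    \<comment> \<open>With \<open>d = 3*c + 1\<close> for \<open>2^(6*m)\<close>, the witness is
      \<open>(8*d^2 - 4*d - 1) / 3\<close>.\<close>
    show "3 * (1/3 * (2^(3*(4*m+1)) - 2^(2*(3*m+1)) - 1)) = (of_int (3 * (24*c^2 + 12*c + 1)) :: rat)"
      unfolding exps powsc by (simp add: algebra_simps power2_eq_square)
    show "0 < 24*c^2 + 12*c + 1"
      using \<open>c > 0\<close> pos by simp
    show "(3 * (24*c^2 + 12*c + 1))^2 = (2^(6*m) - 1) * 2^(18*m+6) + 2^(6*m+3) + 1"
      unfolding powsc by simp algebra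
  qed
  ultimately show ?thesis by blast
qed

theorem theorem2p3:
  fixes m :: nat
  assumes "m > 0"
  shows "(\<exists>T \<subseteq> sols1 m. finite T \<and> card T = 5) \<and>
         (\<exists>T \<subseteq> sols2 m. finite T \<and> card T = 5) \<and>
         {(3, 3),
          (2^(2*m+1) - 2^(m+1) - 1, m+2),
          (2^(3*m+1) - 1, 3*m+2),
          (2^(3*m+2) + 1, 3*m+4),
          (2^(6*m+3) + 2^(3*m+2) - 1, 9*m+6)} \<subseteq> sols1 m \<and>
         {(2^(3*m), 0),
          (1/3 * (2^(4*m+1) + 2^(2*m+1) - 1), 2*m+2),
          (1/3 * (2^(6*m+1) + 1), 6*m+2),
          (1/3 * (2^(6*m+2) - 1), 6*m+4),
          (1/3 * (2^(3*(4*m+1)) - 2^(2*(3*m+1)) - 1), 18*m+6)} \<subseteq> sols2 m"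
proof (intro conjI)
  let ?S1 = "{(3, 3),
          (2^(2*m+1) - 2^(m+1) - 1, m+2),
          (2^(3*m+1) - 1, 3*m+2),
          (2^(3*m+2) + 1, 3*m+4),
          (2^(6*m+3) + 2^(3*m+2) - 1, 9*m+6)} :: (int \<times> nat) set"
  let ?S2 = "{(2^(3*m), 0),
          (1/3 * (2^(4*m+1) + 2^(2*m+1) - 1), 2*m+2),
          (1/3 * (2^(6*m+1) + 1), 6*m+2),
          (1/3 * (2^(6*m+2) - 1), 6*m+4),
          (1/3 * (2^(3*(4*m+1)) - 2^(2*(3*m+1)) - 1), 18*m+6)} :: (rat \<times> nat) set"
  show S1: "?S1 \<subseteq> sols1 m" using assms by (rule listed_subset_sols1)
  show S2: "?S2 \<subseteq> sols2 m" using assms by (rule listed_subset_sols2)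
  show "\<exists>T \<subseteq> sols2 m. finite T \<and> card T = 5"
    using S2 assms by (intro exI[of _ ?S2]) simp
  show "\<exists>T \<subseteq> sols1 m. finite T \<and> card T = 5"
  proof (cases "m = 1")
    case True
    have "{(3, 3), (9, 4), (15, 5), (33, 7), (543, 15)} \<subseteq> sols1 m"
      by (simp add: sols1_def True)
    then show ?thesis by (intro exI[of _ "{(3, 3), (9, 4), (15, 5), (33, 7), (543, 15)}"]) simp
  next
    case False
    \<comment> \<open>Now \<open>m \<ge> 2\<close>, so \<open>3 < m+2\<close> and the five exponents
      increase strictly.\<close>
    then show ?thesis using S1 assms by (intro exI[of _ ?S1]) simp
  qed
qed

end
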